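(* Let $F$ be a finite bipartite graph with at least one edge and without isolated vertices, let $\Delta(F)$ be its maximum degree, and let $n$ be a positive integer such that $F$ is isomorphic to a subgraph of $K_{n,n}$. Then: \begin{enumerate} \item If $\Delta(F)\ge 2$, then $\mathrm{ex}_b(n,F)\ge(\Delta(F)-1)n$. \item If $\Delta(F)=1$ and $F\not\cong K_2$, then $\mathrm{ex}_b(n,F)\ge n$. \item If $\Delta(F)\ge 3$, then $\mathrm{ex}_{b,c}(n,F)\ge(\Delta(F)-1)n$. \item If $F\notin\{K_2,2K_2,P_3,P_3\cup K_2,P_4\}$ (up to isomorphism), then $\mathrm{ex}_{b,c}(n,F)\ge 2n-1$. \end{enumerate} In particular, $\mathrm{ex}_b(n,F)\ge n$ whenever $F$ has more than one edge.
   Context: All graphs are finite and simple. A graph is $F$-free if it has no (not necessarily induced) subgraph isomorphic to $F$. $\mathrm{ex}_b(n,F)$ is the largest number of edges of an $F$-free bipartite graph with both parts of size $n$; $\mathrm{ex}_{b,c}(n,F)$ is the largest number of edges of an $F$-free connected bipartite graph with both parts of size $n$ (part of the assertions in (3),(4) is that such graphs exist). $P_k$ is the path on $k$ vertices, $G\cup H$ the vertex-disjoint union, and $2K_2$ the disjoint union of two edges. *)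

theory Defs
  imports Main
begin

datatype 'a graph = Graph (verts: "'a set") (edges: "'a set set")

definition fin_simple_graph :: "'a graph \<Rightarrow> bool" where
  "fin_simple_graph G \<longleftrightarrow> finite (verts G) \<and>
     (\<forall>e\<in>edges G. \<exists>u\<in>verts G. \<exists>v\<in>verts G. u \<noteq> v \<and> e = {u, v})"

definition subgraph :: "'a graph \<Rightarrow> 'a graph \<Rightarrow> bool" where
  "subgraph H G \<longleftrightarrow> fin_simple_graph H \<and> verts H \<subseteq> verts G \<and> edges H \<subseteq> edges G"

definition isomorphic :: "'a graph \<Rightarrow> 'b graph \<Rightarrow> bool" where
  "isomorphic G H \<longleftrightarrow> (\<exists>f. bij_betw f (verts G) (verts H) \<and>
     (\<forall>u\<in>verts G. \<forall>v\<in>verts G. {u, v} \<in> edges G \<longleftrightarrow> {f u, f v} \<in> edges H))"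

definition isomorphic_to_subgraph :: "'a graph \<Rightarrow> 'b graph \<Rightarrow> bool" where
  "isomorphic_to_subgraph F G \<longleftrightarrow> (\<exists>H. subgraph H G \<and> isomorphic F H)"

definition free_of :: "'a graph \<Rightarrow> 'b graph \<Rightarrow> bool" where
  "free_of F G \<longleftrightarrow> \<not> isomorphic_to_subgraph F G"

definition degree :: "'a graph \<Rightarrow> 'a \<Rightarrow> nat" where
  "degree G v = card {e \<in> edges G. v \<in> e}"

definition max_degree :: "'a graph \<Rightarrow> nat" where
  "max_degree G = Max (degree G ` verts G)"

definition isolated_vertex :: "'a graph \<Rightarrow> 'a \<Rightarrow> bool" where
  "isolated_vertex G v \<longleftrightarrow> v \<in> verts G \<and> degree G v = 0"

definition connected_graph :: "'a graph \<Rightarrow> bool" where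
  "connected_graph G \<longleftrightarrow> verts G \<noteq> {} \<and>
     (\<forall>u\<in>verts G. \<forall>v\<in>verts G. (u, v) \<in> {(x, y). {x, y} \<in> edges G}\<^sup>*)"

definition bipartition :: "'a graph \<Rightarrow> 'a set \<Rightarrow> 'a set \<Rightarrow> bool" where
  "bipartition G A B \<longleftrightarrow> A \<union> B = verts G \<and> A \<inter> B = {} \<and>
     (\<forall>e\<in>edges G. \<exists>a\<in>A. \<exists>b\<in>B. e = {a, b})"

definition bipartite :: "'a graph \<Rightarrow> bool" where
  "bipartite G \<longleftrightarrow> (\<exists>A B. bipartition G A B)"

definition balanced_bipartite :: "nat \<Rightarrow> 'a graph \<Rightarrow> bool" where
  "balanced_bipartite n G \<longleftrightarrow> (\<exists>A B. bipartition G A B \<and> card A = n \<and> card B = n)"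

definition complete_graph :: "nat \<Rightarrow> nat graph" where
  "complete_graph n = Graph {..<n} {{i, j} | i j. i < n \<and> j < n \<and> i \<noteq> j}"

definition complete_bipartite :: "nat \<Rightarrow> nat \<Rightarrow> (nat + nat) graph" where
  "complete_bipartite m n =
     Graph ({..<m} <+> {..<n}) {{Inl i, Inr j} | i j. i < m \<and> j < n}"

text \<open>The parameter is the number of vertices, not the number of edges.\<close>

definition path_graph :: "nat \<Rightarrow> nat graph" where
  "path_graph k = Graph {..<k} {{i, Suc i} | i. Suc i < k}"

definition disjoint_union :: "'a graph \<Rightarrow> 'b graph \<Rightarrow> ('a + 'b) graph" where
  "disjoint_union G H =
     Graph (verts G <+> verts H) ((`) Inl ` edges G \<union> (`) Inr ` edges H)"

text \<open>
  Every finite graph is isomorphic to one with vertices in \<^typ>\<open>nat\<close>, so it is no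
  restriction to let the host graphs below range over \<^typ>\<open>nat graph\<close>.
\<close>

definition hosts :: "nat \<Rightarrow> 'a graph \<Rightarrow> nat graph set" where
  "hosts n F = {G. fin_simple_graph G \<and> balanced_bipartite n G \<and> free_of F G}"

definition connected_hosts :: "nat \<Rightarrow> 'a graph \<Rightarrow> nat graph set" where
  "connected_hosts n F = {G \<in> hosts n F. connected_graph G}"

text \<open>
  \<^const>\<open>Max\<close> is unspecified on the empty set, so a bound on \<open>ex_bc n F\<close> carries its intended
  meaning only together with \<^prop>\<open>connected_hosts n F \<noteq> {}\<close>.
\<close>

definition ex_b :: "nat \<Rightarrow> 'a graph \<Rightarrow> nat" where
  "ex_b n F = Max ((\<lambda>G. card (edges G)) ` hosts n F)"

definition ex_bc :: "nat \<Rightarrow> 'a graph \<Rightarrow> nat" where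
  "ex_bc n F = Max ((\<lambda>G. card (edges G)) ` connected_hosts n F)"

lemma card_edges_hosts_le:
  assumes "G \<in> hosts n F"
  shows "card (edges G) \<le> 2 ^ (2 * n)"
proof -
  from assms obtain A B where AB: "bipartition G A B" "card A = n" "card B = n"
    and G: "fin_simple_graph G"
    unfolding hosts_def balanced_bipartite_def by blast
  have "card (verts G) \<le> 2 * n"
    using card_Un_le[of A B] AB by (simp add: bipartition_def)
  moreover have "finite (verts G)" and "edges G \<subseteq> Pow (verts G)"
    using G unfolding fin_simple_graph_def by auto
  ultimately have "card (edges G) \<le> 2 ^ card (verts G)"
    by (metis card_Pow card_mono finite_Pow_iff)
  also have "\<dots> \<le> 2 ^ (2 * n)"
    using \<open>card (verts G) \<le> 2 * n\<close> by (simp add: power_increasing)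
  finally show ?thesis .
qed

lemma finite_card_edges_hosts: "finite ((\<lambda>G. card (edges G)) ` hosts n F)"
  by (rule finite_subset[of _ "{..2 ^ (2 * n)}"]) (auto intro: card_edges_hosts_le)

lemma finite_card_edges_connected_hosts:
  "finite ((\<lambda>G. card (edges G)) ` connected_hosts n F)"
  by (rule finite_subset[OF _ finite_card_edges_hosts]) (auto simp: connected_hosts_def)

end

theory Submission
  imports Defs
begin

text \<open>
  A \<open>(\<Delta>(F) - 1)\<close>-regular bipartite circulant graph cannot contain \<open>F\<close>, and it is connected
  once \<open>\<Delta>(F) \<ge> 3\<close>; the embedding into \<open>K\<^bsub>n,n\<^esub>\<close> gives \<open>\<Delta>(F) \<le> n\<close>, so it exists. A star contains
  no two disjoint edges, which settles matchings. For \<open>\<Delta>(F) \<le> 2\<close> two trees on \<open>n + n\<close> vertices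
  suffice: the double star contains, among the graphs of maximum degree at most 2 without
  isolated vertices, only the five exceptional ones and \<open>2P\<^sub>3\<close>, while in the spider, obtained from a
  star with \<open>n\<close> leaves by attaching a pendant vertex to all leaves but one, every path on three
  vertices meets the centre, so it contains no \<open>2P\<^sub>3\<close>.
\<close>

section \<open>Embeddings and isomorphisms of graphs\<close>

text \<open>An injective homomorphism: non-edges may become edges, as befits subgraphs that need not
  be induced. Refuting \<open>embeds f F G\<close> for every \<open>f\<close> therefore proves that
  \<open>G\<close> is \<open>F\<close>-free.\<close>

definition embeds :: "('a \<Rightarrow> 'b) \<Rightarrow> 'a graph \<Rightarrow> 'b graph \<Rightarrow> bool" where
  "embeds f F G \<longleftrightarrow> inj_on f (verts F) \<and> (\<forall>e\<in>edges F. f ` e \<in> edges G)"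

lemma edge_subset_verts: "fin_simple_graph F \<Longrightarrow> e \<in> edges F \<Longrightarrow> e \<subseteq> verts F"
  by (auto simp: fin_simple_graph_def dest!: bspec)

lemma finite_edges:
  assumes "fin_simple_graph F"
  shows "finite (edges F)"
proof -
  have "edges F \<subseteq> Pow (verts F)"
    using edge_subset_verts[OF assms] by blast
  then show ?thesis
    using assms by (meson fin_simple_graph_def finite_Pow_iff finite_subset)
qed

lemma isomorphic_sym:
  assumes "isomorphic F H"
  shows "isomorphic H F"
proof -
  from assms obtain f where f: "bij_betw f (verts F) (verts H)"
    and e: "\<And>u v. u \<in> verts F \<Longrightarrow> v \<in> verts F \<Longrightarrow> {u, v} \<in> edges F \<longleftrightarrow> {f u, f v} \<in> edges H"
    unfolding isomorphic_def by blast
  let ?g = "inv_into (verts F) f"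
  have g: "bij_betw ?g (verts H) (verts F)"
    using f by (rule bij_betw_inv_into)
  have "{u, v} \<in> edges H \<longleftrightarrow> {?g u, ?g v} \<in> edges F" if "u \<in> verts H" "v \<in> verts H" for u v
    using that e[of "?g u" "?g v"] bij_betwE[OF g] bij_betw_inv_into_right[OF f] by auto
  with g show ?thesis
    unfolding isomorphic_def by blast
qed

lemma isomorphic_trans:
  assumes "isomorphic F G" "isomorphic G H"
  shows "isomorphic F H"
proof -
  from assms(1) obtain f where f: "bij_betw f (verts F) (verts G)"
    and ef: "\<And>u v. u \<in> verts F \<Longrightarrow> v \<in> verts F \<Longrightarrow> {u, v} \<in> edges F \<longleftrightarrow> {f u, f v} \<in> edges G"
    unfolding isomorphic_def by blast
  from assms(2) obtain g where g: "bij_betw g (verts G) (verts H)"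
    and eg: "\<And>u v. u \<in> verts G \<Longrightarrow> v \<in> verts G \<Longrightarrow> {u, v} \<in> edges G \<longleftrightarrow> {g u, g v} \<in> edges H"
    unfolding isomorphic_def by blast
  have "bij_betw (g \<circ> f) (verts F) (verts H)"
    using f g by (rule bij_betw_trans)
  moreover have "{u, v} \<in> edges F \<longleftrightarrow> {(g \<circ> f) u, (g \<circ> f) v} \<in> edges H"
    if "u \<in> verts F" "v \<in> verts F" for u v
    using that ef eg bij_betwE[OF f] by auto
  ultimately show ?thesis
    unfolding isomorphic_def by blast
qed

text \<open>Surjectivity on vertices is recorded as well; it later carries the absence of isolated
  vertices from \<open>F\<close> over to \<open>H\<close>.\<close>

lemma isomorphic_embeds:
  assumes "fin_simple_graph F" "isomorphic F H"
  obtains f where "embeds f F H" "f ` verts F = verts H"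
proof -
  from assms(2) obtain f where f: "bij_betw f (verts F) (verts H)"
    and e: "\<And>u v. u \<in> verts F \<Longrightarrow> v \<in> verts F \<Longrightarrow> {u, v} \<in> edges F \<longleftrightarrow> {f u, f v} \<in> edges H"
    unfolding isomorphic_def by blast
  have "f ` d \<in> edges H" if "d \<in> edges F" for d
  proof -
    from that assms(1) obtain u v where "u \<in> verts F" "v \<in> verts F" "d = {u, v}"
      unfolding fin_simple_graph_def by blast
    with e that show ?thesis by simp
  qed
  with f that show ?thesis
    unfolding embeds_def bij_betw_def by blast
qed

lemma isomorphic_to_subgraph_embeds:
  assumes "fin_simple_graph F" "isomorphic_to_subgraph F G"
  obtains f where "embeds f F G"
proof -
  from assms(2) obtain H where H: "subgraph H G" "isomorphic F H"
    unfolding isomorphic_to_subgraph_def by blast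
  from isomorphic_embeds[OF assms(1) H(2)] obtain f where "embeds f F H" by blast
  with H(1) that show ?thesis
    unfolding embeds_def subgraph_def by blast
qed

text \<open>Since edges lie inside the vertex set, injectivity of \<open>g\<close> there recovers an
  edge from its image. The map starts at \<open>H\<close>, so for a concrete \<open>H\<close> on
  initial natural numbers it can be given as a list lookup.\<close>

lemma isomorphicI_image:
  assumes "bij_betw g (verts H) (verts F)" "edges F = (`) g ` edges H"
    and "\<And>e. e \<in> edges H \<Longrightarrow> e \<subseteq> verts H"
  shows "isomorphic F H"
proof (rule isomorphic_sym)
  have "{u, v} \<in> edges H \<longleftrightarrow> {g u, g v} \<in> edges F" if "u \<in> verts H" "v \<in> verts H" for u v
  proof
    assume "{g u, g v} \<in> edges F"
    then obtain e where e: "e \<in> edges H" "g ` {u, v} = g ` e"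
      using assms(2) by auto
    moreover have "inj_on g (verts H)"
      using assms(1) by (simp add: bij_betw_def)
    ultimately have "{u, v} = e"
      using that assms(3) by (metis empty_subsetI inj_on_image_eq_iff insert_subset)
    with e show "{u, v} \<in> edges H" by simp
  next
    assume "{u, v} \<in> edges H"
    then have "g ` {u, v} \<in> edges F"
      using assms(2) by blast
    then show "{g u, g v} \<in> edges F" by simp
  qed
  with assms(1) show "isomorphic H F"
    unfolding isomorphic_def by blast
qed

section \<open>Degrees under embeddings\<close>

text \<open>Taking images under \<open>f\<close> is injective on subsets of \<open>verts F\<close>,
  so distinct edges at \<open>v\<close> become distinct edges at \<open>f v\<close>.\<close>

lemma degree_le_embeds:
  assumes "fin_simple_graph F" "finite (edges G)" "embeds f F G"
  shows "degree F v \<le> degree G (f v)"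
  unfolding degree_def
proof (rule card_inj_on_le[where f = "(`) f"])
  have "inj_on ((`) f) (Pow (verts F))"
    using assms(3) by (simp add: embeds_def inj_on_image_Pow)
  then show "inj_on ((`) f) {e \<in> edges F. v \<in> e}"
    by (rule inj_on_subset) (use edge_subset_verts[OF assms(1)] in blast)
  show "(`) f ` {e \<in> edges F. v \<in> e} \<subseteq> {e \<in> edges G. f v \<in> e}"
    using assms(3) by (auto simp: embeds_def)
  show "finite {e \<in> edges G. f v \<in> e}"
    using assms(2) by simp
qed

lemma degree_le_max_degree:
  "fin_simple_graph F \<Longrightarrow> v \<in> verts F \<Longrightarrow> degree F v \<le> max_degree F"
  unfolding max_degree_def fin_simple_graph_def by simp

lemma max_degree_attained:
  assumes "fin_simple_graph F" "verts F \<noteq> {}"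
  obtains v where "v \<in> verts F" "degree F v = max_degree F"
proof -
  have "Max (degree F ` verts F) \<in> degree F ` verts F"
    using assms by (intro Max_in) (auto simp: fin_simple_graph_def)
  with that show ?thesis
    unfolding max_degree_def by fastforce
qed

text \<open>Together with the embedding of \<open>F\<close> into the complete bipartite graph this
  bounds \<open>max_degree F\<close> by \<open>n\<close>, which makes room for the circulant
  hosts.\<close>

lemma degree_complete_bipartite_le: "degree (complete_bipartite n n) v \<le> n"
proof (cases v)
  case (Inl i)
  have "{e \<in> edges (complete_bipartite n n). v \<in> e} \<subseteq> (\<lambda>j. {Inl i, Inr j}) ` {..<n}"
    using Inl by (auto simp: complete_bipartite_def)
  from surj_card_le[OF _ this] show ?thesis
    by (simp add: degree_def)
next
  case (Inr j)
  have "{e \<in> edges (complete_bipartite n n). v \<in> e} \<subseteq> (\<lambda>i. {Inl i, Inr j}) ` {..<n}"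
    using Inr by (auto simp: complete_bipartite_def)
  from surj_card_le[OF _ this] show ?thesis
    by (simp add: degree_def)
qed

lemma finite_edges_complete_bipartite: "finite (edges (complete_bipartite m n))"
proof -
  have "edges (complete_bipartite m n) = (\<lambda>(i, j). {Inl i, Inr j}) ` ({..<m} \<times> {..<n})"
    by (auto simp: complete_bipartite_def)
  then show ?thesis by simp
qed

text \<open>Reduces a lower bound on the extremal number to exhibiting one host; the maximum is over
  a finite set of edge counts.\<close>

lemma card_edges_le_ex_b: "G \<in> hosts n F \<Longrightarrow> card (edges G) \<le> ex_b n F"
  unfolding ex_b_def by (intro Max_ge finite_card_edges_hosts) simp

lemma card_edges_le_ex_bc: "G \<in> connected_hosts n F \<Longrightarrow> card (edges G) \<le> ex_bc n F"
  unfolding ex_bc_def by (intro Max_ge finite_card_edges_connected_hosts) simp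

text \<open>Adjacency is symmetric, so walks from all vertices to one root can be reversed and
  concatenated.\<close>

lemma connected_graphI:
  assumes "r \<in> verts G" "\<And>v. v \<in> verts G \<Longrightarrow> (v, r) \<in> {(x, y). {x, y} \<in> edges G}\<^sup>*"
  shows "connected_graph G"
proof -
  let ?R = "{(x, y). {x, y} \<in> edges G}"
  have "sym (?R\<^sup>*)"
    by (intro sym_rtrancl symI) (auto simp: insert_commute)
  then have "(u, v) \<in> ?R\<^sup>*" if "u \<in> verts G" "v \<in> verts G" for u v
    using that assms(2) by (meson rtrancl_trans symD)
  with assms(1) show ?thesis
    unfolding connected_graph_def by blast
qed

section \<open>Bipartite host graphs given by a relation between the two parts\<close>

text \<open>The vertex \<open>n + j\<close> plays the role of the \<open>j\<close>-th vertex of the second part.\<close>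

definition bip_graph :: "nat \<Rightarrow> (nat \<Rightarrow> nat \<Rightarrow> bool) \<Rightarrow> nat graph" where
  "bip_graph n R = Graph {..<2 * n} {{i, n + j} | i j. i < n \<and> j < n \<and> R i j}"

lemma fin_simple_bip_graph: "fin_simple_graph (bip_graph n R)"
proof -
  have "\<exists>u<2 * n. \<exists>v<2 * n. u \<noteq> v \<and> {i, n + j} = {u, v}" if "i < n" "j < n" for i j
    using that by (intro exI[of _ i] conjI exI[of _ "n + j"]) auto
  then show ?thesis
    by (auto simp: fin_simple_graph_def bip_graph_def Bex_def)
qed

lemma bip_graph_edge:
  assumes "i < n" "j < n" "R i j"
  shows "{i, n + j} \<in> edges (bip_graph n R)" "{n + j, i} \<in> edges (bip_graph n R)"
proof -
  show "{i, n + j} \<in> edges (bip_graph n R)"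
    using assms by (auto simp: bip_graph_def)
  then show "{n + j, i} \<in> edges (bip_graph n R)"
    by (metis insert_commute)
qed

lemma balanced_bip_graph: "balanced_bipartite n (bip_graph n R)"
proof -
  have "bipartition (bip_graph n R) {..<n} {n..<2 * n}"
    unfolding bipartition_def bip_graph_def by fastforce
  then show ?thesis
    unfolding balanced_bipartite_def by fastforce
qed

text \<open>Edges correspond to pairs \<open>(i, j)\<close>: in \<open>{i, n + j}\<close> only the
  first entry is below \<open>n\<close>, so the pair can be read off.\<close>

lemma card_edges_bip_graph:
  "card (edges (bip_graph n R)) = (\<Sum>i<n. card {j. j < n \<and> R i j})"
proof -
  let ?S = "SIGMA i:{..<n}. {j. j < n \<and> R i j}"
  have "edges (bip_graph n R) = (\<lambda>(i, j). {i, n + j}) ` ?S"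
    by (auto simp: bip_graph_def)
  moreover have "inj_on (\<lambda>(i, j). {i, n + j}) ?S"
    by (auto simp: inj_on_def doubleton_eq_iff)
  ultimately have "card (edges (bip_graph n R)) = card ?S"
    by (simp add: card_image)
  then show ?thesis by simp
qed

lemma bip_graph_mem_hosts:
  assumes "fin_simple_graph F" "\<And>f. \<not> embeds f F (bip_graph n R)"
  shows "bip_graph n R \<in> hosts n F"
  unfolding hosts_def free_of_def
  using assms fin_simple_bip_graph balanced_bip_graph
  by (auto elim: isomorphic_to_subgraph_embeds[OF assms(1)])

lemma degree_bip_graph_le:
  assumes "\<And>i. i < n \<Longrightarrow> card {j. j < n \<and> R i j} \<le> k"
    and "\<And>j. j < n \<Longrightarrow> card {i. i < n \<and> R i j} \<le> k"
  shows "degree (bip_graph n R) v \<le> k"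
proof -
  consider (left) "v < n" | (right) j where "v = n + j" "j < n" | (out) "v \<ge> 2 * n"
    by (metis add_less_cancel_left le_iff_add linorder_not_less mult_2)
  then show ?thesis
  proof cases
    case left
    have "{e \<in> edges (bip_graph n R). v \<in> e} \<subseteq> (\<lambda>j. {v, n + j}) ` {j. j < n \<and> R v j}"
      using left by (auto simp: bip_graph_def)
    then have "degree (bip_graph n R) v \<le> card {j. j < n \<and> R v j}"
      unfolding degree_def by (rule surj_card_le[rotated]) simp
    with assms(1)[OF left] show ?thesis by simp
  next
    case right
    have "{e \<in> edges (bip_graph n R). v \<in> e} \<subseteq> (\<lambda>i. {i, n + j}) ` {i. i < n \<and> R i j}"
      using right by (auto simp: bip_graph_def)
    then have "degree (bip_graph n R) v \<le> card {i. i < n \<and> R i j}"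
      unfolding degree_def by (rule surj_card_le[rotated]) simp
    with assms(2)[OF right(2)] show ?thesis by simp
  next
    case out
    then have "{e \<in> edges (bip_graph n R). v \<in> e} = {}"
      by (auto simp: bip_graph_def)
    then show ?thesis
      unfolding degree_def by (metis card.empty le0)
  qed
qed

section \<open>Regular circulant hosts\<close>

text \<open>For \<open>i\<close> and \<open>j\<close> below \<open>n\<close>, the neighbours of
  \<open>i\<close> are \<open>i, i + 1, ..., i + k - 1\<close> modulo \<open>n\<close> when
  \<open>k\<close> is at most \<open>n\<close>. Adding \<open>n\<close> first keeps the
  natural-number subtraction from truncating.\<close>

definition circulant :: "nat \<Rightarrow> nat \<Rightarrow> nat \<Rightarrow> nat \<Rightarrow> bool" where
  "circulant n k i j \<longleftrightarrow> (j + n - i) mod n < k"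

text \<open>An injective self-map of a finite set is a permutation, so each of the values below
  \<open>k\<close> is taken exactly once.\<close>

lemma card_inj_on_preimage:
  fixes h :: "nat \<Rightarrow> nat"
  assumes "inj_on h {..<n}" "\<And>x. x < n \<Longrightarrow> h x < n" "k \<le> n"
  shows "card {x. x < n \<and> h x < k} = k"
proof -
  have "h ` {..<n} = {..<n}"
    using assms(1,2) by (intro card_subset_eq) (auto simp: card_image)
  have "h ` {x. x < n \<and> h x < k} = {..<k}"
  proof (intro equalityI subsetI)
    fix y assume "y \<in> {..<k}"
    with assms(3) \<open>h ` {..<n} = {..<n}\<close> have "y \<in> h ` {..<n}" by simp
    with \<open>y \<in> {..<k}\<close> show "y \<in> h ` {x. x < n \<and> h x < k}" by auto
  qed auto
  moreover have "inj_on h {x. x < n \<and> h x < k}"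
    using assms(1) by (rule inj_on_subset) auto
  ultimately show ?thesis
    by (metis card_image card_lessThan)
qed

text \<open>Removing \<open>mod\<close> turns injectivity of the shift, in \<open>j\<close> for
  fixed \<open>i\<close> and in \<open>i\<close> for fixed \<open>j\<close>, into linear
  arithmetic.\<close>

lemma circulant_shift_mod:
  fixes i j n :: nat
  assumes "i < n" "j < n"
  shows "(j + n - i) mod n = (if i \<le> j then j - i else j + n - i)"
proof (cases "i \<le> j")
  case True
  then have "j + n - i = (j - i) + n" by simp
  then have "(j + n - i) mod n = (j - i) mod n" by (simp only: mod_add_self2)
  with True assms show ?thesis by simp
qed (use assms in simp)

lemma card_circulant:
  assumes "k \<le> n"
  shows "i < n \<Longrightarrow> card {j. j < n \<and> circulant n k i j} = k"
    and "j < n \<Longrightarrow> card {i. i < n \<and> circulant n k i j} = k"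
proof -
  show "card {j. j < n \<and> circulant n k i j} = k" if "i < n"
    unfolding circulant_def using assms that
    by (intro card_inj_on_preimage)
      (auto simp: inj_on_def circulant_shift_mod split: if_splits)
  show "card {i. i < n \<and> circulant n k i j} = k" if "j < n"
    unfolding circulant_def using assms that
    by (intro card_inj_on_preimage)
      (auto simp: inj_on_def circulant_shift_mod split: if_splits)
qed

lemma card_edges_circulant:
  "k \<le> n \<Longrightarrow> card (edges (bip_graph n (circulant n k))) = k * n"
  by (simp add: card_edges_bip_graph card_circulant)

text \<open>A vertex of maximum degree in \<open>F\<close> has no possible image, because every
  degree in the host is at most \<open>k\<close>.\<close>

lemma circulant_mem_hosts:
  assumes "fin_simple_graph F" "verts F \<noteq> {}" "k \<le> n" "k < max_degree F"
  shows "bip_graph n (circulant n k) \<in> hosts n F"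
proof (rule bip_graph_mem_hosts[OF assms(1)])
  fix f
  from max_degree_attained[OF assms(1,2)] obtain v where v: "degree F v = max_degree F" by blast
  have "degree (bip_graph n (circulant n k)) (f v) \<le> k"
    using assms(3) by (intro degree_bip_graph_le) (simp_all add: card_circulant)
  with v assms(4) have "\<not> degree F v \<le> degree (bip_graph n (circulant n k)) (f v)"
    by linarith
  then show "\<not> embeds f F (bip_graph n (circulant n k))"
    using degree_le_embeds[OF assms(1) finite_edges[OF fin_simple_bip_graph]] by blast
qed

text \<open>For \<open>k\<close> at least 2 the shifts 0 and 1 are both available; they form a
  zigzag through \<open>Suc i\<close>, \<open>n + Suc i\<close>, \<open>i\<close> that descends to
  0.\<close>

lemma connected_circulant:
  assumes "n > 0" "k \<ge> 2"
  shows "connected_graph (bip_graph n (circulant n k))"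
proof (rule connected_graphI)
  let ?E = "edges (bip_graph n (circulant n k))"
  let ?R = "{(x, y). {x, y} \<in> ?E}"
  show "0 \<in> verts (bip_graph n (circulant n k))"
    using assms(1) by (simp add: bip_graph_def)
  have diag: "{n + i, i} \<in> ?E" if "i < n" for i
    using that assms by (intro bip_graph_edge) (auto simp: circulant_def)
  have off: "{n + Suc i, i} \<in> ?E" if "Suc i < n" for i
  proof -
    have "circulant n k i (Suc i)"
      using that assms(2) unfolding circulant_def by (subst circulant_shift_mod) auto
    with that show ?thesis
      by (intro bip_graph_edge) auto
  qed
  have left: "(i, 0) \<in> ?R\<^sup>*" if "i < n" for i
    using that
  proof (induction i)
    case (Suc i)
    have "(Suc i, n + Suc i) \<in> ?R"
      using diag[OF Suc.prems] by (simp add: insert_commute)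
    moreover have "(n + Suc i, i) \<in> ?R"
      using off[OF Suc.prems] by simp
    moreover have "(i, 0) \<in> ?R\<^sup>*"
      using Suc by simp
    ultimately show ?case
      by (meson converse_rtrancl_into_rtrancl)
  qed simp
  fix v assume "v \<in> verts (bip_graph n (circulant n k))"
  then have v: "v < 2 * n" by (simp add: bip_graph_def)
  show "(v, 0) \<in> ?R\<^sup>*"
  proof (cases "v < n")
    case False
    with v obtain i where i: "v = n + i" "i < n"
      by (metis add_less_cancel_left le_iff_add linorder_not_less mult_2)
    then have "(v, i) \<in> ?R"
      using diag by simp
    with left[OF i(2)] show ?thesis
      by (meson converse_rtrancl_into_rtrancl)
  qed (rule left)
qed

section \<open>The star, the double star and the spider\<close>

text \<open>The star comes with \<open>n - 1\<close> isolated vertices, which keep the two parts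
  balanced.\<close>

abbreviation star_graph :: "nat \<Rightarrow> nat graph" where
  "star_graph n \<equiv> bip_graph n (\<lambda>i j. i = 0)"

text \<open>A tree whose two adjacent centres are the vertices 0 and \<open>n\<close>.\<close>

abbreviation double_star :: "nat \<Rightarrow> nat graph" where
  "double_star n \<equiv> bip_graph n (\<lambda>i j. i = 0 \<or> j = 0)"

text \<open>The centre is 0. Each leg runs from 0 through \<open>n + i\<close> to \<open>i\<close>
  for positive \<open>i\<close>; the vertex \<open>n\<close> is the neighbour of the centre without
  a pendant vertex.\<close>

abbreviation spider :: "nat \<Rightarrow> nat graph" where
  "spider n \<equiv> bip_graph n (\<lambda>i j. i = 0 \<or> i = j)"

lemma card_edges_star: "n > 0 \<Longrightarrow> card (edges (star_graph n)) = n"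
proof -
  assume "n > 0"
  have "(\<Sum>i<n. card {j. j < n \<and> i = 0}) = (\<Sum>i<n. if i = 0 then n else 0)"
    by (intro sum.cong) auto
  with \<open>n > 0\<close> show ?thesis
    by (simp add: card_edges_bip_graph)
qed

text \<open>Common count for the double star and the spider: 0 contributes \<open>n\<close> edges,
  and each of the other \<open>n - 1\<close> left vertices contributes one, to its only neighbour
  \<open>c i\<close>.\<close>

lemma card_edges_one_centre:
  assumes "n > 0" "\<And>j. j < n \<Longrightarrow> R 0 j" "\<And>i. i < n \<Longrightarrow> c i < n"
    and "\<And>i j. 0 < i \<Longrightarrow> i < n \<Longrightarrow> j < n \<Longrightarrow> R i j \<longleftrightarrow> j = c i"
  shows "card (edges (bip_graph n R)) = 2 * n - 1"
proof -
  \<comment> \<open>Writing \<open>n\<close> as a successor splits the row of the centre off the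
    sum.\<close>
  obtain m where m: "n = Suc m"
    using assms(1) gr0_implies_Suc by blast
  have "card {j. j < n \<and> R 0 j} = card {..<n}"
    using assms(2) by (intro arg_cong[where f = card]) auto
  moreover have "card {j. j < n \<and> R (Suc i) j} = 1" if "i < m" for i
  proof -
    have "{j. j < n \<and> R (Suc i) j} = {c (Suc i)}"
      using assms(3)[of "Suc i"] assms(4)[of "Suc i"] that m by auto
    then show ?thesis by simp
  qed
  ultimately show ?thesis
    unfolding card_edges_bip_graph m sum.lessThan_Suc_shift by simp
qed

lemma card_edges_double_star: "n > 0 \<Longrightarrow> card (edges (double_star n)) = 2 * n - 1"
  by (rule card_edges_one_centre[where c = "\<lambda>_. 0"]) auto

lemma card_edges_spider: "n > 0 \<Longrightarrow> card (edges (spider n)) = 2 * n - 1"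
  by (rule card_edges_one_centre[where c = "\<lambda>i. i"]) auto

text \<open>Right vertices are adjacent to 0, and every left vertex has a right neighbour, so 0 is
  reached in at most two steps.\<close>

lemma connected_one_centre:
  assumes "n > 0" "\<And>j. j < n \<Longrightarrow> R 0 j" "\<And>i. i < n \<Longrightarrow> \<exists>j<n. R i j"
  shows "connected_graph (bip_graph n R)"
proof (rule connected_graphI)
  let ?R = "{(x, y). {x, y} \<in> edges (bip_graph n R)}"
  show "0 \<in> verts (bip_graph n R)"
    using assms(1) by (simp add: bip_graph_def)
  have right: "(n + j, 0) \<in> ?R" if "j < n" for j
    using that assms(1,2) bip_graph_edge(2)[of 0 n j R] by simp
  fix v assume "v \<in> verts (bip_graph n R)"
  then have v: "v < 2 * n" by (simp add: bip_graph_def)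
  show "(v, 0) \<in> ?R\<^sup>*"
  proof (cases "v < n")
    case True
    with assms(3) obtain j where j: "j < n" "R v j" by blast
    with True have "(v, n + j) \<in> ?R"
      using bip_graph_edge(1)[of v n j R] by simp
    with right[OF j(1)] show ?thesis
      by (meson converse_rtrancl_into_rtrancl r_into_rtrancl)
  next
    case False
    with v obtain i where i: "v = n + i" "i < n"
      by (metis add_less_cancel_left le_iff_add linorder_not_less mult_2)
    with right show ?thesis by blast
  qed
qed

lemma connected_double_star: "n > 0 \<Longrightarrow> connected_graph (double_star n)"
  by (rule connected_one_centre) blast+

lemma connected_spider: "n > 0 \<Longrightarrow> connected_graph (spider n)"
  by (rule connected_one_centre) auto

text \<open>All edges of the star share the centre. Under an embedding, all edges of
  \<open>F\<close> would share its unique preimage, and two of them already contradict maximum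
  degree 1.\<close>

lemma star_mem_hosts:
  assumes F: "fin_simple_graph F" and "max_degree F \<le> 1" "card (edges F) > 1"
  shows "star_graph n \<in> hosts n F"
proof (rule bip_graph_mem_hosts[OF F], rule notI)
  fix f assume f: "embeds f F (star_graph n)"
  have hit: "\<exists>v\<in>e. v \<in> verts F \<and> f v = 0" if "e \<in> edges F" for e
  proof -
    have "f ` e \<in> edges (star_graph n)"
      using f that by (simp add: embeds_def)
    then have "0 \<in> f ` e"
      by (auto simp: bip_graph_def)
    with edge_subset_verts[OF F that] show ?thesis by force
  qed
  obtain d e where de: "d \<in> edges F" "e \<in> edges F" "d \<noteq> e"
    using assms(3) by (metis card_le_Suc0_iff_eq finite_edges[OF F] One_nat_def not_less)
  obtain u where u: "u \<in> d" "u \<in> verts F" "f u = 0"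
    using hit[OF de(1)] by blast
  obtain v where v: "v \<in> e" "v \<in> verts F" "f v = 0"
    using hit[OF de(2)] by blast
  have "u = v"
    using f u v by (auto simp: embeds_def inj_on_def)
  with u v de have "{d, e} \<subseteq> {c \<in> edges F. u \<in> c}" by auto
  then have "card {d, e} \<le> degree F u"
    unfolding degree_def using finite_edges[OF F] by (intro card_mono) auto
  with de degree_le_max_degree[OF F u(2)] assms(2) show False by simp
qed

text \<open>Deleting the centre 0 leaves only the pairwise disjoint edges \<open>{i, n + i}\<close>,
  which contain no path on three vertices.\<close>

lemma zero_mem_path_of_spider:
  assumes "{y, u} \<in> edges (spider n)" "{y, v} \<in> edges (spider n)" "u \<noteq> v"
  shows "0 \<in> {y, u, v}"
  using assms by (auto simp: bip_graph_def doubleton_eq_iff)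

text \<open>The images of two disjoint three-vertex paths would be disjoint by injectivity, yet both
  contain the centre.\<close>

lemma spider_no_two_paths:
  assumes "fin_simple_graph H" "embeds f H (spider n)"
    and "{{p, u}, {p, v}, {q, w}, {q, x}} \<subseteq> edges H" "u \<noteq> v" "w \<noteq> x"
    and "{p, u, v} \<inter> {q, w, x} = {}"
  shows False
proof -
  have V: "{p, u, v, q, w, x} \<subseteq> verts H"
    using assms(3) edge_subset_verts[OF assms(1)] by (metis (no_types) insert_subset)
  have inj: "inj_on f (verts H)"
    and E: "\<And>e. e \<in> edges H \<Longrightarrow> f ` e \<in> edges (spider n)"
    using assms(2) by (auto simp: embeds_def)
  have "f u \<noteq> f v" "f w \<noteq> f x"
    using inj V assms(4,5) by (auto simp: inj_on_def)
  moreover have "{f p, f u} \<in> edges (spider n)" "{f p, f v} \<in> edges (spider n)"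
    "{f q, f w} \<in> edges (spider n)" "{f q, f x} \<in> edges (spider n)"
    using E[of "{p, u}"] E[of "{p, v}"] E[of "{q, w}"] E[of "{q, x}"] assms(3) by auto
  ultimately have "0 \<in> {f p, f u, f v} \<and> 0 \<in> {f q, f w, f x}"
    by (intro conjI zero_mem_path_of_spider)
  then have "0 \<in> f ` {p, u, v}" "0 \<in> f ` {q, w, x}" by simp_all
  moreover have "f ` {p, u, v} \<inter> f ` {q, w, x} = f ` ({p, u, v} \<inter> {q, w, x})"
    using inj V by (intro inj_on_image_Int[symmetric]) auto
  ultimately show False
    using assms(6) by auto
qed

section \<open>Recognising the five exceptional graphs\<close>

lemma edges_complete_graph_2: "edges (complete_graph 2) = {{0, 1}}"
proof -
  have "edges (complete_graph 2) = {{i, j} | i j. (i = 0 \<and> j = 1) \<or> (i = 1 \<and> j = 0)}"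
    unfolding complete_graph_def by (simp add: numeral_2_eq_2 less_Suc_eq) force
  then show ?thesis by (auto simp: insert_commute)
qed

lemma verts_complete_graph_2: "verts (complete_graph 2) = {0, 1}"
  by (auto simp: complete_graph_def)

lemma verts_path_graph_3: "verts (path_graph 3) = {0, 1, 2}"
  by (auto simp: path_graph_def)

lemma edges_path_graph_3: "edges (path_graph 3) = {{0, 1}, {1, 2}}"
proof -
  have "edges (path_graph 3) = (\<lambda>i. {i, Suc i}) ` {..<2}"
    by (auto simp: path_graph_def)
  also have "{..<2} = {0, 1 :: nat}" by auto
  finally show ?thesis by (simp add: numeral_2_eq_2)
qed

lemma verts_path_graph_4: "verts (path_graph 4) = {0, 1, 2, 3}"
  by (auto simp: path_graph_def)

lemma edges_path_graph_4: "edges (path_graph 4) = {{0, 1}, {1, 2}, {2, 3}}"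
proof -
  have "edges (path_graph 4) = (\<lambda>i. {i, Suc i}) ` {..<3}"
    by (auto simp: path_graph_def)
  also have "{..<3} = {0, 1, 2 :: nat}" by auto
  finally show ?thesis by (simp add: numeral_2_eq_2 numeral_3_eq_3)
qed

lemma verts_disjoint_union: "verts (disjoint_union G H) = Inl ` verts G \<union> Inr ` verts H"
  by (auto simp: disjoint_union_def)

lemma edges_disjoint_union:
  "edges (disjoint_union G H) = (`) Inl ` edges G \<union> (`) Inr ` edges H"
  by (simp add: disjoint_union_def)

lemmas small_graph_simps = verts_disjoint_union edges_disjoint_union verts_complete_graph_2 edges_complete_graph_2
  verts_path_graph_3 edges_path_graph_3 verts_path_graph_4 edges_path_graph_4

text \<open>Here and below, the isomorphism from the model graph looks up the vertex number in the
  list of named vertices.\<close>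

lemma isomorphic_K2I:
  assumes "verts H = {x, y}" "edges H = {{x, y}}" "x \<noteq> y"
  shows "isomorphic H (complete_graph 2)"
  by (rule isomorphicI_image[where g = "\<lambda>i. [x, y] ! i"])
    (use assms in \<open>auto simp: small_graph_simps bij_betw_def\<close>)

lemma isomorphic_P3I:
  assumes "verts H = {x, y, z}" "edges H = {{x, y}, {y, z}}" "distinct [x, y, z]"
  shows "isomorphic H (path_graph 3)"
  by (rule isomorphicI_image[where g = "\<lambda>i. [x, y, z] ! i"])
    (use assms in \<open>auto simp: small_graph_simps bij_betw_def\<close>)

lemma isomorphic_P4I:
  assumes "verts H = {x, y, z, w}" "edges H = {{x, y}, {y, z}, {z, w}}" "distinct [x, y, z, w]"
  shows "isomorphic H (path_graph 4)"
  by (rule isomorphicI_image[where g = "\<lambda>i. [x, y, z, w] ! i"])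
    (use assms in \<open>auto simp: small_graph_simps bij_betw_def\<close>)

lemma isomorphic_2K2I:
  assumes "verts H = {x, y, z, w}" "edges H = {{x, y}, {z, w}}" "distinct [x, y, z, w]"
  shows "isomorphic H (disjoint_union (complete_graph 2) (complete_graph 2))"
  \<comment> \<open>\<open>case_sum\<close> combines one vertex list for each component of the
    disjoint union.\<close>
  by (rule isomorphicI_image[where g = "case_sum (\<lambda>i. [x, y] ! i) (\<lambda>i. [z, w] ! i)"])
    (use assms in \<open>force simp: small_graph_simps bij_betw_def\<close>)+

lemma isomorphic_P3_K2I:
  assumes "verts H = {x, y, z, v, w}" "edges H = {{x, y}, {y, z}, {v, w}}"
    and "distinct [x, y, z, v, w]"
  shows "isomorphic H (disjoint_union (path_graph 3) (complete_graph 2))"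
  by (rule isomorphicI_image[where g = "case_sum (\<lambda>i. [x, y, z] ! i) (\<lambda>i. [v, w] ! i)"])
    (use assms in \<open>force simp: small_graph_simps bij_betw_def\<close>)+

definition exceptional :: "'a graph \<Rightarrow> bool" where
  "exceptional H \<longleftrightarrow> isomorphic H (complete_graph 2) \<or>
     isomorphic H (disjoint_union (complete_graph 2) (complete_graph 2)) \<or>
     isomorphic H (path_graph 3) \<or>
     isomorphic H (disjoint_union (path_graph 3) (complete_graph 2)) \<or>
     isomorphic H (path_graph 4)"

lemma exceptional_isomorphic: "isomorphic F H \<Longrightarrow> exceptional H \<Longrightarrow> exceptional F"
  unfolding exceptional_def by (elim disjE; drule (1) isomorphic_trans; simp)

lemma card_le_2_cases:
  assumes "finite A" "card A \<le> 2"
  obtains "A = {}" | x where "A = {x}" | x y where "A = {x, y}" "x \<noteq> y"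
proof -
  have "card A = 0 \<or> card A = 1 \<or> card A = 2"
    using assms(2) by linarith
  with assms(1) that show ?thesis
    by (metis card_0_eq card_1_singletonE card_2_iff)
qed

text \<open>\<open>P\<close> and \<open>Q\<close> hold the further neighbours of \<open>p\<close>
  and \<open>q\<close>. The edge \<open>{p, q}\<close> is thus prolonged by at most one edge at
  either end, giving a path on two, three or four vertices.\<close>

lemma exceptional_adjacent_centres:
  assumes "p \<noteq> q" "{p, q} \<inter> (P \<union> Q) = {}" "P \<inter> Q = {}"
    and "finite P" "finite Q" "card P \<le> 1" "card Q \<le> 1"
    and E: "edges H = insert {p, q} ((\<lambda>v. {p, v}) ` P \<union> (\<lambda>v. {q, v}) ` Q)"
    and V: "verts H = \<Union>(edges H)"
  shows "exceptional H"
proof -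
  have "P = {} \<or> (\<exists>x. P = {x})" "Q = {} \<or> (\<exists>x. Q = {x})"
    using assms(4-7) by (metis card_0_eq card_1_singletonE le_neq_implies_less less_one)+
  then consider "P = {}" "Q = {}" | x where "P = {x}" "Q = {}" | y where "P = {}" "Q = {y}"
    | x y where "P = {x}" "Q = {y}" by blast
  then show ?thesis
  proof cases
    case 1
    then have "isomorphic H (complete_graph 2)"
      using assms by (intro isomorphic_K2I[of H p q]) auto
    then show ?thesis by (simp add: exceptional_def)
  next
    case (2 x)
    then have "isomorphic H (path_graph 3)"
      using assms by (intro isomorphic_P3I[of H x p q]) auto
    then show ?thesis by (simp add: exceptional_def)
  next
    case (3 y)
    then have "isomorphic H (path_graph 3)"
      using assms by (intro isomorphic_P3I[of H p q y]) auto
    then show ?thesis by (simp add: exceptional_def)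
  next
    case (4 x y)
    then have "isomorphic H (path_graph 4)"
      using assms by (intro isomorphic_P4I[of H x p q y]) auto
    then show ?thesis by (simp add: exceptional_def)
  qed
qed

text \<open>\<open>H\<close> consists of disjoint stars at \<open>p\<close> and \<open>q\<close>.
  Ordering them by size leaves one or two leaves at \<open>p\<close> and at most one at
  \<open>q\<close>: four graphs, with two disjoint three-vertex paths excluded by the bound on
  \<open>Q\<close>.\<close>

lemma exceptional_nonadjacent_centres:
  assumes "p \<noteq> q" "{p, q} \<inter> (P \<union> Q) = {}" "P \<inter> Q = {}"
    and "finite P" "finite Q" "card P \<le> 2" "card Q \<le> card P" "card Q \<le> 1" "edges H \<noteq> {}"
    and E: "edges H = (\<lambda>v. {p, v}) ` P \<union> (\<lambda>v. {q, v}) ` Q"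
    and V: "verts H = \<Union>(edges H)"
  shows "exceptional H"
proof -
  have Q: "Q = {} \<or> (\<exists>x. Q = {x})"
    using assms(5,8) by (metis card_0_eq card_1_singletonE le_neq_implies_less less_one)
  from assms(4,6) show ?thesis
  proof (cases rule: card_le_2_cases)
    case 1
    \<comment> \<open>As \<open>Q\<close> is no larger than \<open>P\<close>, both are empty,
      against the existence of an edge.\<close>
    with assms(5,7,9) E show ?thesis by simp
  next
    case (2 x)
    from Q show ?thesis
    proof (elim disjE exE)
      assume "Q = {}"
      with 2 have "isomorphic H (complete_graph 2)"
        using assms by (intro isomorphic_K2I[of H p x]) auto
      then show ?thesis by (simp add: exceptional_def)
    next
      fix y assume "Q = {y}"
      with 2 have "isomorphic H (disjoint_union (complete_graph 2) (complete_graph 2))"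
        using assms by (intro isomorphic_2K2I[of H p x q y]) auto
      then show ?thesis by (simp add: exceptional_def)
    qed
  next
    case (3 x z)
    from Q show ?thesis
    proof (elim disjE exE)
      assume "Q = {}"
      with 3 have "isomorphic H (path_graph 3)"
        using assms by (intro isomorphic_P3I[of H x p z]) auto
      then show ?thesis by (simp add: exceptional_def)
    next
      fix y assume "Q = {y}"
      with 3 have "isomorphic H (disjoint_union (path_graph 3) (complete_graph 2))"
        using assms by (intro isomorphic_P3_K2I[of H x p z q y]) auto
      then show ?thesis by (simp add: exceptional_def)
    qed
  qed
qed

section \<open>Subgraphs of the double star with maximum degree at most 2\<close>

lemma card_nbrs_le_degree:
  assumes "fin_simple_graph H"
  shows "finite {u. {p, u} \<in> edges H}" "card {u. {p, u} \<in> edges H} \<le> degree H p"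
proof -
  have inj: "inj_on (\<lambda>u. {p, u}) A" for A
    by (auto simp: inj_on_def doubleton_eq_iff)
  have sub: "(\<lambda>u. {p, u}) ` {u. {p, u} \<in> edges H} \<subseteq> {e \<in> edges H. p \<in> e}" by auto
  have fin: "finite {e \<in> edges H. p \<in> e}"
    using finite_edges[OF assms] by simp
  show "finite {u. {p, u} \<in> edges H}"
    using inj sub fin by (meson finite_imageD finite_subset)
  show "card {u. {p, u} \<in> edges H} \<le> degree H p"
    unfolding degree_def using inj sub fin by (rule card_inj_on_le)
qed

text \<open>Every edge meets a centre, so the neighbourhoods of 0 and \<open>n\<close> determine
  \<open>H\<close>. The degree bound leaves, beyond the exceptional graphs, only two disjoint
  three-vertex paths, and the embedding into the spider rules these out.\<close>

lemma subgraph_double_star_exceptional: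
  assumes H: "subgraph H (double_star n)" and deg: "\<And>v. degree H v \<le> 2"
    and V: "verts H = \<Union>(edges H)" and ne: "edges H \<noteq> {}"
    and g: "embeds g H (spider n)"
  shows "exceptional H"
proof -
  have simple: "fin_simple_graph H"
    and sub: "edges H \<subseteq> edges (double_star n)"
    using H by (auto simp: subgraph_def)
  \<comment> \<open>Each set omits the opposite centre, so \<open>P\<close> lies above
    \<open>n\<close> and \<open>Q\<close> strictly between 0 and \<open>n\<close>.\<close>
  define P where "P = {v. {0, v} \<in> edges H} - {n}"
  define Q where "Q = {v. {n, v} \<in> edges H} - {0}"
  have n: "n > 0"
    using sub ne by (auto simp: bip_graph_def)
  have P: "n < v" if "v \<in> P" for v
    using that sub by (fastforce simp: P_def bip_graph_def doubleton_eq_iff)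
  have Q: "0 < v" "v < n" if "v \<in> Q" for v
    using that sub by (fastforce simp: Q_def bip_graph_def doubleton_eq_iff)+
  have shape: "0 \<noteq> n" "{0, n} \<inter> (P \<union> Q) = {}" "P \<inter> Q = {}"
    using n P Q by fastforce+
  have fin: "finite P" "finite Q"
    using card_nbrs_le_degree(1)[OF simple] by (auto simp: P_def Q_def)
  have cover: "\<exists>v. e = {0, v} \<or> e = {n, v}" if "e \<in> edges H" for e
  proof -
    from that sub have "e \<in> edges (double_star n)" by blast
    then obtain i j where "e = {i, n + j}" "i = 0 \<or> j = 0"
      by (auto simp: bip_graph_def)
    then show ?thesis by (auto simp: insert_commute)
  qed
  show ?thesis
  proof (cases "{0, n} \<in> edges H")
    case True
    \<comment> \<open>The edge joining the centres takes up one of the at most two edges at 0, and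
      likewise at \<open>n\<close>.\<close>
    have "card P \<le> 1"
      using True deg[of 0] card_nbrs_le_degree(2)[OF simple, of 0]
      unfolding P_def by (subst card_Diff_singleton) auto
    moreover have "card Q \<le> 1"
      using True deg[of n] card_nbrs_le_degree(2)[OF simple, of n]
      unfolding Q_def by (subst card_Diff_singleton) (auto simp: insert_commute)
    moreover have "edges H = insert {0, n} ((\<lambda>v. {0, v}) ` P \<union> (\<lambda>v. {n, v}) ` Q)"
    proof (intro equalityI subsetI)
      fix e assume e: "e \<in> edges H"
      with cover obtain v where "e = {0, v} \<or> e = {n, v}" by blast
      then have "e = {0, n} \<or> (\<exists>v\<in>P. e = {0, v}) \<or> (\<exists>v\<in>Q. e = {n, v})"
      proof
        assume v: "e = {0, v}"
        show ?thesis
        proof (cases "v = n")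
          case False
          with e v have "v \<in> P" by (simp add: P_def)
          with v show ?thesis by blast
        qed (use v in simp)
      next
        assume v: "e = {n, v}"
        show ?thesis
        proof (cases "v = 0")
          case False
          with e v have "v \<in> Q" by (simp add: Q_def)
          with v show ?thesis by blast
        qed (use v in \<open>simp add: insert_commute\<close>)
      qed
      then show "e \<in> insert {0, n} ((\<lambda>v. {0, v}) ` P \<union> (\<lambda>v. {n, v}) ` Q)"
        by (simp add: image_iff)
    next
      fix e assume "e \<in> insert {0, n} ((\<lambda>v. {0, v}) ` P \<union> (\<lambda>v. {n, v}) ` Q)"
      with True show "e \<in> edges H"
        by (auto simp: P_def Q_def)
    qed
    ultimately show ?thesis
      using shape fin V by (intro exceptional_adjacent_centres)
  next
    case False
    have P': "P = {v. {0, v} \<in> edges H}" and Q': "Q = {v. {n, v} \<in> edges H}"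
      using False by (auto simp: P_def Q_def insert_commute)
    have c: "card P \<le> 2" "card Q \<le> 2"
      unfolding P' Q' using deg card_nbrs_le_degree(2)[OF simple] order_trans by blast+
    have E: "edges H = (\<lambda>v. {0, v}) ` P \<union> (\<lambda>v. {n, v}) ` Q"
      using cover unfolding P' Q' by fastforce
    \<comment> \<open>Two leaves at each centre would give two disjoint three-vertex paths inside
      the spider.\<close>
    have "\<not> (card P = 2 \<and> card Q = 2)"
    proof
      assume "card P = 2 \<and> card Q = 2"
      then obtain u v w x where uv: "P = {u, v}" "u \<noteq> v" and wx: "Q = {w, x}" "w \<noteq> x"
        by (metis card_2_iff)
      show False
        by (rule spider_no_two_paths[OF simple g, of 0 u v n w x])
          (use uv wx E shape in auto)
    qed
    then consider "card Q \<le> card P" "card Q \<le> 1" | "card P \<le> card Q" "card P \<le> 1"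
      using c by linarith
    then show ?thesis
    proof cases
      case 1
      with shape fin c ne E V show ?thesis
        by (intro exceptional_nonadjacent_centres)
    next
      case 2
      \<comment> \<open>The centre \<open>n\<close> now has at least as many leaves, so the two
        centres exchange roles.\<close>
      have "edges H = (\<lambda>v. {n, v}) ` Q \<union> (\<lambda>v. {0, v}) ` P"
        using E by (simp add: Un_commute)
      with 2 shape fin c ne V show ?thesis
        by (intro exceptional_nonadjacent_centres[of n 0 Q P]) auto
    qed
  qed
qed

lemma embeds_comp:
  assumes "embeds f F G" "embeds g G H" "f ` verts F \<subseteq> verts G"
  shows "embeds (g \<circ> f) F H"
proof -
  have "inj_on (g \<circ> f) (verts F)"
    using assms by (auto simp: embeds_def intro: comp_inj_on inj_on_subset)
  with assms(1,2) show ?thesis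
    unfolding embeds_def by (metis image_comp)
qed

text \<open>If both trees contained \<open>F\<close>, its copy \<open>H\<close> in the double star
  would also embed into the spider, and the classification would make \<open>F\<close>
  exceptional.\<close>

lemma double_star_or_spider_mem_hosts:
  assumes F: "fin_simple_graph F" and deg: "max_degree F \<le> 2"
    and V: "verts F = \<Union>(edges F)" and ne: "edges F \<noteq> {}" and exc: "\<not> exceptional F"
  shows "double_star n \<in> hosts n F \<or> spider n \<in> hosts n F"
proof (rule ccontr)
  assume contra: "\<not> (double_star n \<in> hosts n F \<or> spider n \<in> hosts n F)"
  then obtain g where g: "embeds g F (spider n)"
    using bip_graph_mem_hosts[OF F] by blast
  from contra obtain H where H: "subgraph H (double_star n)" "isomorphic F H"
    unfolding hosts_def free_of_def isomorphic_to_subgraph_def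
    using fin_simple_bip_graph balanced_bip_graph by blast
  have simple: "fin_simple_graph H"
    using H(1) by (simp add: subgraph_def)
  from isomorphic_embeds[OF F H(2)] obtain f where f: "embeds f F H" "f ` verts F = verts H"
    by blast
  \<comment> \<open>Both directions matter: \<open>f\<close> shows that \<open>H\<close> has no
    isolated vertices, while \<open>h\<close> yields its degree bound and, composed with
    \<open>g\<close>, its embedding into the spider.\<close>
  from isomorphic_embeds[OF simple isomorphic_sym[OF H(2)]] obtain h
    where h: "embeds h H F" "h ` verts H = verts F" by blast
  have "degree H v \<le> 2" for v
  proof (cases "v \<in> verts H")
    case True
    then have "degree F (h v) \<le> 2"
      using h(2) deg degree_le_max_degree[OF F] by (metis imageI order_trans)
    with degree_le_embeds[OF simple finite_edges[OF F] h(1)] show ?thesis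
      by (meson order_trans)
  next
    case False
    then have "{e \<in> edges H. v \<in> e} = {}"
      using edge_subset_verts[OF simple] by blast
    then show ?thesis
      unfolding degree_def by (metis card.empty le0)
  qed
  moreover have "verts H = \<Union>(edges H)"
  proof
    show "\<Union>(edges H) \<subseteq> verts H"
      using edge_subset_verts[OF simple] by blast
    show "verts H \<subseteq> \<Union>(edges H)"
    proof
      fix v assume "v \<in> verts H"
      then obtain u where "u \<in> verts F" "v = f u"
        using f(2) by blast
      then obtain e where "e \<in> edges F" "v \<in> f ` e"
        using V by blast
      with f(1) show "v \<in> \<Union>(edges H)"
        unfolding embeds_def by blast
    qed
  qed
  moreover have "edges H \<noteq> {}"
    using f(1) ne by (auto simp: embeds_def)
  moreover have "embeds (g \<circ> h) H (spider n)"
    using h g by (intro embeds_comp) auto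
  ultimately have "exceptional H"
    using H(1) by (intro subgraph_double_star_exceptional)
  with exc exceptional_isomorphic[OF H(2)] show False by blast
qed

section \<open>Choosing a host for each of the five bounds\<close>

theorem proposition3:
  fixes F :: "'a graph" and n :: nat
  assumes "fin_simple_graph F" and "bipartite F"
    and "edges F \<noteq> {}" and "\<nexists>v. isolated_vertex F v"
    and "n > 0" and "isomorphic_to_subgraph F (complete_bipartite n n)"
  shows "(max_degree F \<ge> 2 \<longrightarrow> ex_b n F \<ge> (max_degree F - 1) * n) \<and>
    (max_degree F = 1 \<and> \<not> isomorphic F (complete_graph 2) \<longrightarrow> ex_b n F \<ge> n) \<and>
    (max_degree F \<ge> 3 \<longrightarrow>
       connected_hosts n F \<noteq> {} \<and> ex_bc n F \<ge> (max_degree F - 1) * n) \<and>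
    (\<not> isomorphic F (complete_graph 2) \<and>
     \<not> isomorphic F (disjoint_union (complete_graph 2) (complete_graph 2)) \<and>
     \<not> isomorphic F (path_graph 3) \<and>
     \<not> isomorphic F (disjoint_union (path_graph 3) (complete_graph 2)) \<and>
     \<not> isomorphic F (path_graph 4) \<longrightarrow>
       connected_hosts n F \<noteq> {} \<and> ex_bc n F \<ge> 2 * n - 1) \<and>
    (card (edges F) > 1 \<longrightarrow> ex_b n F \<ge> n)"
proof -
  note F = assms(1)
  have degree_pos: "degree F v \<noteq> 0" if "v \<in> verts F" for v
    using assms(4) that by (simp add: isolated_vertex_def)
  have V: "verts F = \<Union>(edges F)"
  proof
    show "\<Union>(edges F) \<subseteq> verts F"
      using edge_subset_verts[OF F] by blast
    show "verts F \<subseteq> \<Union>(edges F)"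
    proof
      fix v assume "v \<in> verts F"
      then have "degree F v \<noteq> 0" by (rule degree_pos)
      then have "{e \<in> edges F. v \<in> e} \<noteq> {}"
        unfolding degree_def by (metis card.empty)
      then show "v \<in> \<Union>(edges F)" by blast
    qed
  qed
  obtain e where e: "e \<in> edges F"
    using assms(3) by blast
  then obtain x y where xy: "e = {x, y}" "x \<noteq> y" "x \<in> verts F"
    using F unfolding fin_simple_graph_def by blast
  then have ne: "verts F \<noteq> {}" by blast
  \<comment> \<open>Hence \<open>max_degree F - 1\<close> is strictly below
    \<open>max_degree F\<close> despite truncated subtraction.\<close>
  have pos: "max_degree F \<ge> 1"
    using degree_pos[OF xy(3)] degree_le_max_degree[OF F xy(3)] by simp
  obtain f where f: "embeds f F (complete_bipartite n n)"
    using isomorphic_to_subgraph_embeds[OF F assms(6)] .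
  have max_le: "max_degree F \<le> n"
  proof -
    obtain v where "degree F v = max_degree F"
      using max_degree_attained[OF F ne] by blast
    with degree_le_embeds[OF F finite_edges_complete_bipartite f, of v]
      degree_complete_bipartite_le[of n "f v"] show ?thesis by simp
  qed
  have part1: "ex_b n F \<ge> (max_degree F - 1) * n"
  proof -
    have "bip_graph n (circulant n (max_degree F - 1)) \<in> hosts n F"
      using max_le pos by (intro circulant_mem_hosts F ne) auto
    then show ?thesis
      using card_edges_le_ex_b card_edges_circulant[of "max_degree F - 1" n] max_le by fastforce
  qed
  have matching: "ex_b n F \<ge> n" if "max_degree F = 1" "card (edges F) > 1"
    using card_edges_le_ex_b[OF star_mem_hosts[OF F, of n]] that card_edges_star[OF assms(5)]
    by simp
  have part2: "ex_b n F \<ge> n" if "max_degree F = 1" "\<not> isomorphic F (complete_graph 2)"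
  proof (rule matching[OF that(1)], rule ccontr)
    \<comment> \<open>A single edge and no isolated vertices would make \<open>F\<close> a copy of
      \<open>complete_graph 2\<close>.\<close>
    assume "\<not> card (edges F) > 1"
    then have "edges F = {{x, y}}"
      using e xy(1) finite_edges[OF F] by (auto simp: card_le_Suc0_iff_eq not_less)
    with V xy(2) that(2) show False
      using isomorphic_K2I[of F x y] by simp
  qed
  have part3: "connected_hosts n F \<noteq> {} \<and> ex_bc n F \<ge> (max_degree F - 1) * n"
    if "max_degree F \<ge> 3"
  proof -
    \<comment> \<open>The circulant has \<open>k = max_degree F - 1\<close>, which is now at least
      2, as its connectedness requires.\<close>
    have "bip_graph n (circulant n (max_degree F - 1)) \<in> connected_hosts n F"
      unfolding connected_hosts_def
      using that max_le assms(5) by (auto intro!: circulant_mem_hosts connected_circulant F ne)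
    then show ?thesis
      using card_edges_le_ex_bc card_edges_circulant[of "max_degree F - 1" n] max_le by fastforce
  qed
  have part4: "connected_hosts n F \<noteq> {} \<and> ex_bc n F \<ge> 2 * n - 1" if "\<not> exceptional F"
  proof (cases "max_degree F \<ge> 3")
    case True
    have "2 * n - 1 \<le> (max_degree F - 1) * n"
      using True mult_le_mono1[of 2 "max_degree F - 1" n] by linarith
    with part3[OF True] show ?thesis by linarith
  next
    case False
    then have "max_degree F \<le> 2" by simp
    then have "double_star n \<in> hosts n F \<or> spider n \<in> hosts n F"
      using F V assms(3) that by (intro double_star_or_spider_mem_hosts)
    \<comment> \<open>Whichever tree is \<open>F\<close>-free serves: both are connected with
      \<open>2 * n - 1\<close> edges.\<close>
    then have "\<exists>G \<in> connected_hosts n F. card (edges G) = 2 * n - 1"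
      unfolding connected_hosts_def using assms(5) card_edges_double_star card_edges_spider
        connected_double_star connected_spider by blast
    then show ?thesis
      using card_edges_le_ex_bc by fastforce
  qed
  have part5: "ex_b n F \<ge> n" if "card (edges F) > 1"
  proof (cases "max_degree F = 1")
    case True
    with that matching show ?thesis by blast
  next
    case False
    with pos have "1 * n \<le> (max_degree F - 1) * n"
      by (intro mult_le_mono1) linarith
    then have "n \<le> (max_degree F - 1) * n" by simp
    with part1 show ?thesis by (rule order_trans[rotated])
  qed
  show ?thesis
    using part1 part2 part3 part4 part5 unfolding exceptional_def by blast
qed

end
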